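(* Any one-pass streaming algorithm for the $k$-Path problem on $n$-vertex graphs given as insertion-only edge streams requires $\Omega(n\log n)$ bits of space, even for $k=5$.
   Context: $k$-Path: given an undirected graph $G$ on $n$ vertices, decide whether $G$ has a path of length at least $k$ (i.e., a path on at least $k+1$ vertices). Streaming model: the vertex set is fixed, the edges arrive one by one and are only inserted. Lower bounds apply to all algorithms, including randomized ones that answer correctly with constant probability (say at least $2/3$). *)

theory Defs
  imports "HOL-Probability.Probability" "HOL-Library.Landau_Symbols"
begin

definition all_edges :: "nat \<Rightarrow> nat set set" where
  "all_edges n = {{u, v} |u v. u < n \<and> v < n \<and> u \<noteq> v}"

text \<open>A stream lists the edges of a simple graph with vertex set \<open>{..<n}\<close>, each edge once,
  in arbitrary order. Not asking an algorithm to handle repeated edges can only make a space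
  lower bound stronger.\<close>

definition edge_streams :: "nat \<Rightarrow> nat set list set" where
  "edge_streams n = {es. distinct es \<and> set es \<subseteq> all_edges n}"

definition is_path :: "nat \<Rightarrow> nat set set \<Rightarrow> nat list \<Rightarrow> bool" where
  "is_path n E p \<longleftrightarrow>
     p \<noteq> [] \<and> distinct p \<and> set p \<subseteq> {..<n} \<and> successively (\<lambda>u v. {u, v} \<in> E) p"

definition path_length :: "nat list \<Rightarrow> nat" where
  "path_length p = length p - 1"

definition k_path :: "nat \<Rightarrow> nat \<Rightarrow> nat set set \<Rightarrow> bool" where
  "k_path k n E \<longleftrightarrow> (\<exists>p. is_path n E p \<and> path_length p \<ge> k)"

text \<open>The memory is a bit string. Computation is non-uniform: updates are arbitrary functions.
  Randomness comes both as a read-only seed, available throughout the pass and not charged as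
  space, and as fresh coins in every step, which are forgotten unless stored in memory. A
  deterministic algorithm is the case where all distributions are point masses.\<close>

record 'r stream_alg =
  seed_dist :: "'r pmf"
  init_mem :: "'r \<Rightarrow> bool list pmf"
  update_mem :: "'r \<Rightarrow> bool list \<Rightarrow> nat set \<Rightarrow> bool list pmf"
  output_bit :: "'r \<Rightarrow> bool list \<Rightarrow> bool pmf"

primrec process :: "'r stream_alg \<Rightarrow> 'r \<Rightarrow> nat set list \<Rightarrow> bool list \<Rightarrow> bool list pmf" where
  "process A r [] m = return_pmf m"
| "process A r (e # es) m = bind_pmf (update_mem A r m e) (process A r es)"

definition memory_after :: "'r stream_alg \<Rightarrow> 'r \<Rightarrow> nat set list \<Rightarrow> bool list pmf" where
  "memory_after A r es = bind_pmf (init_mem A r) (process A r es)"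

definition answer :: "'r stream_alg \<Rightarrow> nat set list \<Rightarrow> bool pmf" where
  "answer A es =
     bind_pmf (seed_dist A) (\<lambda>r. bind_pmf (memory_after A r es) (output_bit A r))"

definition solves_k_path :: "real \<Rightarrow> nat \<Rightarrow> nat \<Rightarrow> 'r stream_alg \<Rightarrow> bool" where
  "solves_k_path p k n A \<longleftrightarrow>
     (\<forall>es \<in> edge_streams n. pmf (answer A es) (k_path k n (set es)) \<ge> p)"

text \<open>Prefixes of streams are again streams, so this bounds the memory at every time of the pass.\<close>

definition space_at_most :: "nat \<Rightarrow> 'r stream_alg \<Rightarrow> nat \<Rightarrow> bool" where
  "space_at_most n A s \<longleftrightarrow>
     (\<forall>es \<in> edge_streams n. \<forall>r \<in> set_pmf (seed_dist A).
        \<forall>m \<in> set_pmf (memory_after A r es). length m \<le> s)"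

end

theory Submission
  imports Defs "HOL-Library.Nat_Bijection"
begin

text \<open>Alice holds a function \<open>f\<close> from \<open>N\<close> points to the words of \<open>L\<close> bits, \<open>N = 2 ^ L\<close>, and streams
  the edges \<open>a\<^sub>j b\<^bsub>f j\<^esub>\<close>. To read bit \<open>i\<close> of \<open>f j\<close>, Bob appends a pendant edge \<open>x a\<^sub>j\<close>, a path
  \<open>c y z\<close>, and the edges from \<open>c\<close> to all \<open>b\<^sub>v\<close> for which bit \<open>i\<close> of \<open>v\<close> is set. If the bit is set,
  \<open>x a\<^sub>j b\<^bsub>f j\<^esub> c y z\<close> is a path of length 5; otherwise \<open>c\<close> is the root of a tree of depth 2 that
  does not contain \<open>a\<^sub>j\<close>, and all other components have diameter at most 3.
  So the memory after Alice's part solves the index problem on \<open>N * L\<close> independent bits.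

  For the index problem with \<open>k\<close> bits and \<open>s\<close> bits of memory, let \<open>Z\<close> be the number of bits that Bob
  guesses correctly, in expectation over his coins. Its mean is at least \<open>2 * k / 3\<close>, so the mean of
  \<open>2 powr Z\<close> is at least \<open>2 powr (2 * k / 3)\<close> by convexity. On the other hand, a fixed memory state
  contributes at most \<open>(3 / 2) ^ k\<close> to the mean over all inputs, and there are fewer than
  \<open>2 ^ (s + 1)\<close> states. As \<open>2 powr (2 / 3) > 3 / 2\<close>, the space \<open>s\<close> is linear in \<open>k\<close>.\<close>

section \<open>Splitting a stream and counting memory states\<close>

lemma process_append:
  "process A r (xs @ ys) m = bind_pmf (process A r xs m) (process A r ys)"
  by (induction xs arbitrary: m) (simp_all add: bind_return_pmf bind_assoc_pmf cong: bind_pmf_cong)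

text \<open>Exposes the memory between the two parts of the stream, which acts as Alice's one-way
  message to Bob.\<close>

lemma answer_append:
  "answer A (xs @ ys) = bind_pmf (seed_dist A) (\<lambda>r. bind_pmf (memory_after A r xs)
     (\<lambda>m. bind_pmf (process A r ys m) (output_bit A r)))"
  by (simp add: answer_def memory_after_def process_append bind_assoc_pmf)

lemma card_bool_lists_atMost_le: "real (card {m :: bool list. length m \<le> s}) \<le> 2 ^ (s + 1)"
proof -
  have "card {m :: bool list. length m \<le> s} = (\<Sum>i\<le>s. 2 ^ i)"
    using card_lists_length_le[of "UNIV :: bool set" s] by simp
  also have "\<dots> < 2 ^ (s + 1)"
    by (induction s) auto
  finally show ?thesis
    by (metis less_imp_le of_nat_le_iff of_nat_numeral of_nat_power)
qed

lemma finite_bool_lists_atMost: "finite {m :: bool list. length m \<le> s}"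
  using finite_lists_length_le[of "UNIV :: bool set" s] by simp

section \<open>Exponential moments of the number of correct guesses\<close>

text \<open>With \<open>t = 2 powr p\<close> between 1 and 2, the claim
  \<open>t + 2 / t \<le> 3\<close> is \<open>(t - 1) * (2 - t) \<ge> 0\<close> divided by
  \<open>t\<close>.\<close>

lemma two_powr_add_le_3:
  fixes p :: real
  assumes "0 \<le> p" "p \<le> 1"
  shows "2 powr p + 2 powr (1 - p) \<le> 3"
proof -
  have "0 \<le> (2 powr p - 1) * (2 - 2 powr p)"
    using assms powr_mono[of p 1 2] by (intro mult_nonneg_nonneg) (auto simp: ge_one_powr_ge_zero)
  also have "\<dots> = 2 powr p * (3 - (2 powr p + 2 powr (1 - p)))"
    by (simp add: algebra_simps powr_diff)
  finally show ?thesis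
    by (simp add: zero_le_mult_iff)
qed

text \<open>Here \<open>p q\<close> is Bob's guess for \<open>q \<in> X\<close> from a fixed memory state.\<close>

lemma sum_Pow_exp_correct_le:
  fixes p :: "'q \<Rightarrow> bool pmf"
  assumes "finite Q"
  shows "(\<Sum>X\<in>Pow Q. 2 powr (\<Sum>q\<in>Q. pmf (p q) (q \<in> X))) \<le> 3 ^ card Q"
proof -
  have split: "2 powr (\<Sum>q\<in>Q. pmf (p q) (q \<in> X)) =
      (\<Prod>q\<in>X. 2 powr pmf (p q) True) * (\<Prod>q\<in>Q - X. 2 powr pmf (p q) False)"
    if "X \<in> Pow Q" for X
  proof -
    have "2 powr (\<Sum>q\<in>Q. pmf (p q) (q \<in> X)) = (\<Prod>q\<in>Q. 2 powr pmf (p q) (q \<in> X))"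
      using assms by (simp add: powr_sum)
    also have "\<dots> = (\<Prod>q\<in>Q - X. 2 powr pmf (p q) (q \<in> X)) * (\<Prod>q\<in>X. 2 powr pmf (p q) (q \<in> X))"
      using assms that by (intro prod.subset_diff) auto
    finally show ?thesis by (simp add: mult.commute)
  qed
  \<comment> \<open>Expanding the product over \<open>q\<close> picks one of two summands for each
    \<open>q\<close>, and these choices are the subsets \<open>X\<close>.\<close>
  have "(\<Sum>X\<in>Pow Q. 2 powr (\<Sum>q\<in>Q. pmf (p q) (q \<in> X))) =
      (\<Prod>q\<in>Q. 2 powr pmf (p q) True + 2 powr pmf (p q) False)"
    unfolding prod_add[OF assms] by (rule sum.cong[OF refl split])
  also have "\<dots> \<le> (\<Prod>q\<in>Q. 3)"
    using two_powr_add_le_3[OF pmf_nonneg pmf_le_1]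
    by (intro prod_mono) (auto simp: pmf_False_conv_True)
  finally show ?thesis by simp
qed

lemma two_powr_ge_tangent:
  fixes z z0 :: real
  shows "2 powr z0 * (1 + ln 2 * (z - z0)) \<le> 2 powr z"
proof -
  have "2 powr z0 * (1 + ln 2 * (z - z0)) \<le> 2 powr z0 * exp (ln 2 * (z - z0))"
    by (intro mult_left_mono exp_ge_add_one_self) auto
  also have "\<dots> = 2 powr z"
    by (simp add: powr_def exp_add [symmetric] algebra_simps)
  finally show ?thesis .
qed

text \<open>Jensen's inequality, with the tangent taken at \<open>z\<close> instead of the mean; its
  positive slope absorbs the gap between the two.\<close>

lemma expectation_two_powr_ge:
  fixes f :: "'a \<Rightarrow> real"
  assumes "\<And>x. 0 \<le> f x" "\<And>x. f x \<le> B" "z \<le> measure_pmf.expectation M f"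
  shows "2 powr z \<le> measure_pmf.expectation M (\<lambda>x. 2 powr f x)"
proof -
  have int: "integrable M f"
    using assms by (intro measure_pmf.integrable_const_bound[where B = B]) auto
  have int': "integrable M (\<lambda>x. 2 powr f x)"
    using assms by (intro measure_pmf.integrable_const_bound[where B = "2 powr B"]) auto
  have "2 powr z * 1 \<le> 2 powr z * (1 + ln 2 * (measure_pmf.expectation M f - z))"
    using assms(3) by (intro mult_left_mono) auto
  also have "\<dots> = measure_pmf.expectation M (\<lambda>x. 2 powr z * (1 + ln 2 * (f x - z)))"
    using int by simp
  also have "\<dots> \<le> measure_pmf.expectation M (\<lambda>x. 2 powr f x)"
    using int int' by (intro integral_mono two_powr_ge_tangent) auto
  finally show ?thesis by simp
qed

text \<open>A crude bound by \<open>pmf M x \<le> 1\<close>. It replaces a memory distribution that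
  depends on Alice's input by a sum over all states, which can be swapped with the sum over
  inputs.\<close>

lemma expectation_le_sum:
  fixes f :: "'a \<Rightarrow> real"
  assumes "finite S" "set_pmf M \<subseteq> S" "\<And>x. 0 \<le> f x"
  shows "measure_pmf.expectation M f \<le> sum f S"
proof -
  have "measure_pmf.expectation M f = (\<Sum>x\<in>S. pmf M x * f x)"
    using assms by (subst integral_measure_pmf[of S]) auto
  also have "\<dots> \<le> (\<Sum>x\<in>S. 1 * f x)"
    using assms by (intro sum_mono mult_right_mono pmf_le_1) auto
  finally show ?thesis by simp
qed

lemma expectation_bind_pmf_bounded:
  fixes f :: "'b \<Rightarrow> real"
  assumes "\<And>y. \<bar>f y\<bar> \<le> B"
  shows "measure_pmf.expectation (bind_pmf M K) f =
    measure_pmf.expectation M (\<lambda>x. measure_pmf.expectation (K x) f)"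
proof -
  have "measure_pmf.expectation (bind_pmf M K) f = integral\<^sup>L (measure_pmf M \<bind> (\<lambda>x. measure_pmf (K x))) f"
    by (simp add: measure_pmf_bind)
  also have "\<dots> = measure_pmf.expectation M (\<lambda>x. measure_pmf.expectation (K x) f)"
    by (rule integral_bind[where K = "count_space UNIV" and B' = 1 and B = B])
       (use assms in \<open>auto simp: measurable_count_space_eq1 measure_pmf_in_subprob_algebra
          measure_pmf.emeasure_space_1\<close>)
  finally show ?thesis .
qed

section \<open>The index problem\<close>

lemma index_lower_bound:
  fixes A :: "'r stream_alg" and alice :: "'q set \<Rightarrow> nat set list" and bob :: "'q \<Rightarrow> nat set list"
  assumes fin: "finite Q"
    and correct: "\<And>X q. X \<subseteq> Q \<Longrightarrow> q \<in> Q \<Longrightarrow> 2/3 \<le> pmf (answer A (alice X @ bob q)) (q \<in> X)"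
    and space: "\<And>X r m. X \<subseteq> Q \<Longrightarrow> r \<in> set_pmf (seed_dist A) \<Longrightarrow>
                  m \<in> set_pmf (memory_after A r (alice X)) \<Longrightarrow> length m \<le> s"
  shows "card Q \<le> 15 * (s + 1)"
proof -
  define D where "D r m q = bind_pmf (process A r (bob q) m) (output_bit A r)" for r m q
  define Z where "Z X r m = (\<Sum>q\<in>Q. pmf (D r m q) (q \<in> X))" for X r m
  \<comment> \<open>Bob's continuation reads the seed as well as the memory, so the pair is
    kept.\<close>
  define J where "J X = bind_pmf (seed_dist A) (\<lambda>r. map_pmf (Pair r) (memory_after A r (alice X)))" for X
  define k where "k = card Q"
  have Z_nonneg: "0 \<le> Z X r m" and Z_le: "Z X r m \<le> k" for X r m
    using sum_bounded_above[of Q "\<lambda>q. pmf (D r m q) (q \<in> X)" 1]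
    by (auto simp: Z_def k_def sum_nonneg pmf_le_1)
  have ans: "pmf (answer A (alice X @ bob q)) b = measure_pmf.expectation (J X) (\<lambda>(r, m). pmf (D r m q) b)"
    for X q b
  proof -
    have "answer A (alice X @ bob q) = bind_pmf (J X) (\<lambda>(r, m). D r m q)"
      by (simp add: answer_append J_def D_def bind_assoc_pmf bind_map_pmf)
    then show ?thesis by (simp add: pmf_bind case_prod_unfold)
  qed
  have low: "2 powr (2/3 * k) \<le> measure_pmf.expectation (J X) (\<lambda>(r, m). 2 powr Z X r m)"
    if "X \<subseteq> Q" for X
  proof -
    have "2/3 * k = (\<Sum>q\<in>Q. 2/3)" by (simp add: k_def)
    also have "\<dots> \<le> (\<Sum>q\<in>Q. pmf (answer A (alice X @ bob q)) (q \<in> X))"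
      using that correct by (intro sum_mono) auto
    also have "\<dots> = measure_pmf.expectation (J X) (\<lambda>x. \<Sum>q\<in>Q. pmf (D (fst x) (snd x) q) (q \<in> X))"
      unfolding ans case_prod_unfold
      by (rule Bochner_Integration.integral_sum[symmetric], rule measure_pmf.integrable_const_bound[where B = 1])
         (auto simp: pmf_le_1)
    finally have "2/3 * k \<le> measure_pmf.expectation (J X) (\<lambda>x. Z X (fst x) (snd x))"
      by (simp add: Z_def)
    from expectation_two_powr_ge[OF Z_nonneg Z_le this] show ?thesis
      by (simp add: case_prod_unfold)
  qed
  define W where "W X r = measure_pmf.expectation (memory_after A r (alice X)) (\<lambda>m. 2 powr Z X r m)" for X r
  have W_nonneg: "0 \<le> W X r" for X r
    by (simp add: W_def)
  have W_le: "W X r \<le> 2 powr k" for X r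
    unfolding W_def
    by (intro measure_pmf.integral_le_const measure_pmf.integrable_const_bound[where B = "2 powr k"])
       (auto simp: Z_le)
  have JW: "measure_pmf.expectation (J X) (\<lambda>(r, m). 2 powr Z X r m) =
      measure_pmf.expectation (seed_dist A) (W X)" for X
    unfolding J_def W_def
    by (subst expectation_bind_pmf_bounded[where B = "2 powr k"]) (auto simp: Z_le)
  \<comment> \<open>With the seed fixed first, only memory states are counted, so the size of the
    seed does not enter.\<close>
  have high: "(\<Sum>X\<in>Pow Q. W X r) \<le> 2 ^ (s + 1) * 3 ^ k" if r: "r \<in> set_pmf (seed_dist A)" for r
  proof -
    let ?M = "{m :: bool list. length m \<le> s}"
    have "(\<Sum>X\<in>Pow Q. W X r) \<le> (\<Sum>X\<in>Pow Q. \<Sum>m\<in>?M. 2 powr Z X r m)"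
      unfolding W_def using space r
      by (intro sum_mono expectation_le_sum finite_bool_lists_atMost) auto
    also have "\<dots> = (\<Sum>m\<in>?M. \<Sum>X\<in>Pow Q. 2 powr Z X r m)"
      by (rule sum.swap)
    also have "\<dots> \<le> (\<Sum>m\<in>?M. 3 ^ k)"
      unfolding Z_def k_def by (intro sum_mono sum_Pow_exp_correct_le fin)
    also have "\<dots> \<le> 2 ^ (s + 1) * 3 ^ k"
      using card_bool_lists_atMost_le[of s] by (simp add: mult_right_mono)
    finally show ?thesis .
  qed
  have intW: "integrable (seed_dist A) (W X)" for X
    by (intro measure_pmf.integrable_const_bound[where B = "2 powr k"]) (auto simp: W_nonneg W_le)
  have "2 ^ k * 2 powr (2/3 * k) = (\<Sum>X\<in>Pow Q. 2 powr (2/3 * k))"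
    using fin by (simp add: card_Pow k_def)
  also have "\<dots> \<le> (\<Sum>X\<in>Pow Q. measure_pmf.expectation (seed_dist A) (W X))"
    using low by (intro sum_mono) (auto simp: JW)
  also have "\<dots> = measure_pmf.expectation (seed_dist A) (\<lambda>r. \<Sum>X\<in>Pow Q. W X r)"
    using intW by simp
  also have "\<dots> \<le> 2 ^ (s + 1) * 3 ^ k"
    using high intW by (intro measure_pmf.integral_le_const) (auto simp: AE_measure_pmf_iff)
  finally have main: "2 ^ k * 2 powr (2/3 * k) \<le> 2 ^ (s + 1) * (3 :: real) ^ k" .
  \<comment> \<open>As \<open>3 ^ 5 = 243\<close> and \<open>2 ^ 8 = 256\<close>. Comparing
    exponents in \<open>main\<close> then leaves \<open>5/3 - 8/5 = 1/15\<close>, whence the factor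
    15.\<close>
  have "log 2 3 \<le> 8/5"
  proof -
    have "5 * log 2 3 = log 2 (3 ^ 5)" by (subst log_nat_power) auto
    also have "\<dots> \<le> log 2 (2 ^ 8)" by (subst log_le_cancel_iff) auto
    also have "\<dots> = 8" by (subst log_nat_power) auto
    finally show ?thesis by simp
  qed
  have "k + 2/3 * k = log 2 (2 ^ k * 2 powr (2/3 * k))"
    by (simp add: log_mult log_nat_power)
  also have "\<dots> \<le> log 2 (2 ^ (s + 1) * 3 ^ k)"
    using main by simp
  also have "\<dots> = (s + 1) + k * log 2 3"
    by (simp add: log_mult log_nat_power)
  also have "\<dots> \<le> (s + 1) + k * (8/5)"
    using \<open>log 2 3 \<le> 8/5\<close> by (intro add_left_mono mult_left_mono) auto
  finally have "real k \<le> 15 * (s + 1)" by simp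
  then show ?thesis unfolding k_def by linarith
qed

section \<open>The graph construction\<close>

text \<open>The vertices of the construction are \<open>a\<^sub>j = j\<close>, \<open>b\<^sub>v = N + v\<close>, \<open>c = 2 * N\<close>, \<open>x = 2 * N + 1\<close>,
  \<open>y = 2 * N + 2\<close> and \<open>z = 2 * N + 3\<close>.\<close>

definition alice_edges :: "nat \<Rightarrow> (nat \<Rightarrow> nat) \<Rightarrow> nat set set" where
  "alice_edges N f = (\<lambda>j. {j, N + f j}) ` {..<N}"

definition bob_edges :: "nat \<Rightarrow> nat \<Rightarrow> nat set \<Rightarrow> nat set set" where
  "bob_edges N j B =
     {{2 * N + 1, j}, {2 * N, 2 * N + 2}, {2 * N + 2, 2 * N + 3}} \<union> (\<lambda>v. {2 * N, N + v}) ` B"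

lemma alice_edges_subset:
  "f ` {..<N} \<subseteq> {..<N} \<Longrightarrow> 2 * N \<le> n \<Longrightarrow> alice_edges N f \<subseteq> all_edges n"
  unfolding alice_edges_def all_edges_def by fastforce

lemma bob_edges_subset:
  "j < N \<Longrightarrow> B \<subseteq> {..<N} \<Longrightarrow> 2 * N + 4 \<le> n \<Longrightarrow> bob_edges N j B \<subseteq> all_edges n"
  unfolding bob_edges_def all_edges_def by fastforce

text \<open>Needed because a stream lists no edge twice.\<close>

lemma alice_bob_edges_disjoint:
  "f ` {..<N} \<subseteq> {..<N} \<Longrightarrow> j < N \<Longrightarrow> B \<subseteq> {..<N} \<Longrightarrow> alice_edges N f \<inter> bob_edges N j B = {}"
  by (auto simp: alice_edges_def bob_edges_def doubleton_eq_iff image_subset_iff subset_iff)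

lemma five_path_if_mem:
  assumes "f ` {..<N} \<subseteq> {..<N}" "j < N" "f j \<in> B" "2 * N + 4 \<le> n"
  shows "k_path 5 n (alice_edges N f \<union> bob_edges N j B)"
proof -
  have "f j < N" using assms by auto
  then have "is_path n (alice_edges N f \<union> bob_edges N j B)
      [2 * N + 1, j, N + f j, 2 * N, 2 * N + 2, 2 * N + 3]"
    using assms by (auto simp: is_path_def alice_edges_def bob_edges_def insert_commute)
  then show ?thesis
    unfolding k_path_def path_length_def by (intro exI conjI) auto
qed

text \<open>A path of length 5 has four consecutive inner vertices. An edge between inner vertices
  contains \<open>c\<close> or joins \<open>j\<close> to \<open>N + f j\<close>. The three edges
  between these four cannot all contain \<open>c\<close>, so the second kind occurs, next to an edge
  at \<open>c\<close>; but \<open>c\<close> is adjacent to neither of its ends when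
  \<open>f j\<close> is not in \<open>B\<close>.\<close>

lemma mem_if_five_path:
  assumes f: "f ` {..<N} \<subseteq> {..<N}" and j: "j < N" and B: "B \<subseteq> {..<N}"
    and path: "k_path 5 n (alice_edges N f \<union> bob_edges N j B)"
  shows "f j \<in> B"
proof (rule ccontr)
  assume notin: "f j \<notin> B"
  define E where "E = alice_edges N f \<union> bob_edges N j B"
  \<comment> \<open>The remaining vertices have degree at most 1, so they can only be ends of a path.\<close>
  define inner where "inner v \<longleftrightarrow> v = j \<or> N \<le> v \<and> v < 2 * N \<or> v = 2 * N \<or> v = 2 * N + 2" for v
  define arc where "arc u v \<longleftrightarrow> u < N \<and> v = N + f u \<or> u = 2 * N + 1 \<and> v = j \<or>
      u = 2 * N \<and> v = 2 * N + 2 \<or> u = 2 * N + 2 \<and> v = 2 * N + 3 \<or>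
      u = 2 * N \<and> v \<in> (+) N ` B" for u v
  have arcs: "arc u v \<or> arc v u" if "{u, v} \<in> E" for u v
  proof -
    have "\<exists>x y. {u, v} = {x, y} \<and> arc x y"
      using that unfolding E_def alice_edges_def bob_edges_def
      by (elim UnE imageE insertE) (unfold arc_def, blast+)
    then show ?thesis by (auto simp: doubleton_eq_iff)
  qed
  have fN: "f u < N" if "u < N" for u using f that by auto
  have BN: "N \<le> v \<and> v < 2 * N" if "v \<in> (+) N ` B" for v using B that by auto
  \<comment> \<open>The only possible neighbour of a vertex that is not inner; the last branch
    serves \<open>z\<close>, whose neighbour is \<open>y\<close>.\<close>
  define nb where "nb v = (if v < N then N + f v else if v = 2 * N + 1 then j else 2 * N + 2)" for v
  have leaf: "u = nb v" if "{u, v} \<in> E" "\<not> inner v" for u v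
    using arcs[OF that(1)] unfolding arc_def
    by (elim disjE conjE; use that(2) j fN[of u] BN[of u] BN[of v] in \<open>simp add: nb_def inner_def\<close>)
  have inner: "inner v" if "{u, v} \<in> E" "{v, w} \<in> E" "u \<noteq> w" for u v w
    using leaf[of u v] leaf[of w v] that by (auto simp: insert_commute)
  have edge: "u = 2 * N \<or> v = 2 * N \<or> u = j \<and> v = N + f j \<or> v = j \<and> u = N + f j"
    if "{u, v} \<in> E" "inner u" "inner v" for u v
    using arcs[OF that(1)] unfolding arc_def
    by (elim disjE conjE; use that(2,3) j in \<open>simp add: inner_def; linarith?\<close>)
  have sep: "{j, 2 * N} \<notin> E" "{N + f j, 2 * N} \<notin> E"
    using arcs[of j "2 * N"] arcs[of "N + f j" "2 * N"] j fN[of j] BN[of j] notin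
    unfolding arc_def by auto
  obtain p where p: "is_path n E p" "5 \<le> path_length p"
    using path unfolding k_path_def E_def by blast
  then have len: "6 \<le> length p" by (simp add: path_length_def)
  have dist: "p ! i \<noteq> p ! k" if "i < 6" "k < 6" "i \<noteq> k" for i k
    using p(1) len that by (simp add: is_path_def nth_eq_iff_index_eq)
  have adj: "{p ! i, p ! Suc i} \<in> E" if "i < 5" for i
    using p(1) len that by (simp add: is_path_def successively_conv_nth)
  \<comment> \<open>Positions 1 to 4 have two distinct neighbours on the path.\<close>
  have inn: "inner (p ! Suc i)" if "i < 4" for i
    using inner[OF adj adj, of i] dist[of i "Suc (Suc i)"] that by auto
  let ?a = "p ! 1" and ?b = "p ! 2" and ?c = "p ! 3" and ?d = "p ! 4"
  have adj': "{?a, ?b} \<in> E" "{?b, ?c} \<in> E" "{?c, ?d} \<in> E"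
    using adj[of 1] adj[of 2] adj[of 3] by (simp_all add: numeral_eq_Suc)
  have inn': "inner ?a" "inner ?b" "inner ?c" "inner ?d"
    using inn[of 0] inn[of 1] inn[of 2] inn[of 3] by (simp_all add: numeral_eq_Suc)
  have dist': "?a \<noteq> ?b" "?a \<noteq> ?c" "?a \<noteq> ?d" "?b \<noteq> ?c" "?b \<noteq> ?d" "?c \<noteq> ?d"
    by (rule dist; simp)+
  have sep': "{2 * N, j} \<notin> E" "{2 * N, N + f j} \<notin> E"
    using sep by (simp_all add: insert_commute)
  note edges = edge[OF adj'(1) inn'(1,2)] edge[OF adj'(2) inn'(2,3)] edge[OF adj'(3) inn'(3,4)]
  show False
  proof (cases "?a = 2 * N \<or> ?b = 2 * N")
    case True
    then have "?c = j \<or> ?c = N + f j" "?b = 2 * N"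
      using edges(2,3) dist' by auto
    then show False using adj'(2) sep' by metis
  next
    case False
    then have "?b = j \<or> ?b = N + f j" "?c = 2 * N"
      using edges(1,2) dist' by auto
    then show False using adj'(2) sep by metis
  qed
qed

section \<open>From the index problem to the asymptotic bound\<close>

lemma five_path_space_lower_bound:
  fixes A :: "'r stream_alg"
  assumes "solves_k_path (2/3) 5 n A" "space_at_most n A s" "2 * 2 ^ L + 4 \<le> n"
  shows "2 ^ L * L \<le> 15 * (s + 1)"
proof -
  define N :: nat where "N = 2 ^ L"
  define Q where "Q = {..<N} \<times> {..<L}"
  \<comment> \<open>Row \<open>j\<close> of the bit table \<open>X\<close>, read as a binary
    number.\<close>
  define f where "f X j = set_encode {i. (j, i) \<in> X}" for X :: "(nat \<times> nat) set" and j :: nat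
  define B where "B i = {v. v < N \<and> i \<in> set_decode v}" for i
  have fin: "finite {i. (j, i) \<in> X}" if "X \<subseteq> Q" for X j
    by (rule finite_subset[of _ "{..<L}"]) (use that in \<open>auto simp: Q_def\<close>)
  have f_less: "f X j < N" if "X \<subseteq> Q" for X j
  proof -
    have "{i. (j, i) \<in> X} \<subseteq> {..<L}" using that by (auto simp: Q_def)
    then have "f X j \<le> (\<Sum>i<L. 2 ^ i)"
      unfolding f_def set_encode_def by (intro sum_mono2) auto
    also have "\<dots> < 2 ^ L"
      by (induction L) auto
    finally show ?thesis by (simp add: N_def)
  qed
  have f_in_B: "f X j \<in> B i \<longleftrightarrow> (j, i) \<in> X" if "X \<subseteq> Q" for X j i
    using f_less[OF that] fin[OF that] by (simp add: B_def f_def)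
  have subs: "f X ` {..<N} \<subseteq> {..<N}" "B i \<subseteq> {..<N}" if "X \<subseteq> Q" for X i
    using f_less[OF that] by (auto simp: B_def)
  have n: "2 * N + 4 \<le> n" using assms(3) by (simp add: N_def)
  have "\<exists>xs. distinct xs \<and> set xs = alice_edges N (f X)" for X
    by (metis finite_distinct_list alice_edges_def finite_imageI finite_lessThan)
  then obtain alice where alice: "\<And>X. distinct (alice X)" "\<And>X. set (alice X) = alice_edges N (f X)"
    by metis
  have bob_finite: "finite (bob_edges N (fst q) (B (snd q)))" for q
    by (simp add: bob_edges_def B_def)
  have "\<exists>xs. distinct xs \<and> set xs = bob_edges N (fst q) (B (snd q))" for q
    by (metis finite_distinct_list bob_finite)
  then obtain bob where bob: "\<And>q. distinct (bob q)" "\<And>q. set (bob q) = bob_edges N (fst q) (B (snd q))"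
    by metis
  have "card Q \<le> 15 * (s + 1)"
  proof (rule index_lower_bound[of Q A alice bob])
    show "finite Q" by (simp add: Q_def)
    fix X assume X: "X \<subseteq> Q"
    have alice_sub: "alice_edges N (f X) \<subseteq> all_edges n"
      using subs[OF X] n by (intro alice_edges_subset) auto
    then have "alice X \<in> edge_streams n"
      using alice by (simp add: edge_streams_def)
    then show "length m \<le> s" if "r \<in> set_pmf (seed_dist A)" "m \<in> set_pmf (memory_after A r (alice X))" for r m
      using assms(2) that by (auto simp: space_at_most_def)
    fix q assume q: "q \<in> Q"
    obtain j i where ji: "q = (j, i)" "j < N" using q by (auto simp: Q_def)
    have "alice X @ bob q \<in> edge_streams n"
      using alice_sub alice_bob_edges_disjoint[OF subs(1)[OF X] ji(2) subs(2)[OF X]]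
        bob_edges_subset[OF ji(2) subs(2)[OF X] n] ji(1)
      by (simp add: edge_streams_def alice bob)
    then have "2/3 \<le> pmf (answer A (alice X @ bob q)) (k_path 5 n (set (alice X @ bob q)))"
      using assms(1) by (auto simp: solves_k_path_def)
    moreover have "k_path 5 n (set (alice X @ bob q)) \<longleftrightarrow> q \<in> X"
      using five_path_if_mem[OF subs(1)[OF X] ji(2) _ n] f_in_B[OF X]
        mem_if_five_path[OF subs(1)[OF X] ji(2) subs(2)[OF X]] ji(1)
      by (auto simp: alice bob)
    ultimately show "2/3 \<le> pmf (answer A (alice X @ bob q)) (q \<in> X)" by simp
  qed
  then show ?thesis by (simp add: Q_def N_def)
qed

theorem theorem20:
  fixes A :: "nat \<Rightarrow> 'r stream_alg" and S :: "nat \<Rightarrow> nat"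
  assumes "\<And>n. solves_k_path (2/3) 5 n (A n)"
    and "\<And>n. space_at_most n (A n) (S n)"
  shows "(\<lambda>n. real (S n)) \<in> \<Omega>(\<lambda>n. real n * log 2 (real n))"
proof (rule landau_omega.bigI)
  show "0 < (1 / 512 :: real)" by simp
  show "\<forall>\<^sub>F n in sequentially. 1 / 512 * norm (real n * log 2 (real n)) \<le> norm (real (S n))"
  proof (rule eventually_sequentiallyI)
    fix n :: nat assume n: "512 \<le> n"
    \<comment> \<open>The largest \<open>L\<close> with \<open>2 ^ L \<le> n div 4\<close>: the
      construction fits into \<open>n\<close> vertices, and \<open>2 ^ L\<close> is still more than
      \<open>n / 8\<close>.\<close>
    obtain L where L: "2 ^ L \<le> n div 4" "n div 4 < 2 ^ (L + 1)"
    proof -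
      have "1 \<le> n div 4" using n by linarith
      then show ?thesis using ex_power_ivl1[of 2 "n div 4"] that by auto
    qed
    have up: "n < 2 ^ (L + 3)" using L(2) by (simp add: power_add)
    have "2 ^ L * L \<le> 15 * (S n + 1)"
      using L(1) n by (intro five_path_space_lower_bound[OF assms]) linarith
    then have "real (2 ^ L * L) \<le> real (15 * (S n + 1))"
      by (simp only: of_nat_le_iff)
    then have bound: "2 ^ L * real L \<le> 15 * (real (S n) + 1)" by simp
    have "real n < real (2 ^ (L + 3))"
      using up by (simp only: of_nat_less_iff)
    then have less: "real n < 2 ^ (L + 3)" by simp
    then have N: "real n / 8 \<le> 2 ^ L" by (simp add: power_add)
    have "log 2 (real n) \<le> log 2 (2 ^ (L + 3))"
      using less n by (subst log_le_cancel_iff) auto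
    also have "\<dots> = real (L + 3)" by (subst log_nat_power) auto
    finally have logL: "log 2 (real n) - 3 \<le> L" by simp
    have "log 2 (2 ^ 9) \<le> log 2 (real n)" using n by (subst log_le_cancel_iff) auto
    then have log9: "9 \<le> log 2 (real n)" by (subst (asm) log_nat_power) auto
    \<comment> \<open>From \<open>log 2 n \<ge> 9\<close> it follows that \<open>log 2 n - 3\<close>
      is at least two thirds of \<open>log 2 n\<close>.\<close>
    have "real n / 8 * (log 2 (real n) * (2 / 3)) \<le> 2 ^ L * real L"
      using N logL log9 by (intro mult_mono) auto
    with bound have "real n * log 2 (real n) / 12 \<le> 15 * (real (S n) + 1)" by simp
    \<comment> \<open>Absorbs the additive 15: the constant \<open>1 / 180 - 1 / 4608\<close> that
      results exceeds \<open>1 / 512\<close>.\<close>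
    moreover have "512 * 9 \<le> real n * log 2 (real n)"
      using n log9 by (intro mult_mono) auto
    ultimately show "1 / 512 * norm (real n * log 2 (real n)) \<le> norm (real (S n))"
      using log9 by simp
  qed
qed

end
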